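(* Let $X$ and $Y$ be digital images. Then every punctuated homotopy $H : X \times [0,k]_{\mathbb{Z}} \to Y$ is a strong homotopy.
   Context: A digital image is a set $X$ together with a symmetric, antireflexive adjacency relation on $X$. A function $f : X \to Y$ between digital images is continuous if whenever $x$ is adjacent to $x'$, the points $f(x)$ and $f(x')$ are adjacent or equal. For integers $a\le b$, $[a,b]_{\mathbb{Z}} = \{a,a+1,\dots,b\}$, a digital image in which $s,t$ are adjacent iff $|s-t|=1$. Let $k$ be a positive integer. A homotopy between continuous functions $f,g:X\to Y$ is a function $H : X \times [0,k]_{\mathbb{Z}} \to Y$ such that $H(x,0)=f(x)$ and $H(x,k)=g(x)$ for all $x$; for each fixed $x$ the function $t \mapsto H(x,t)$ is continuous; and for each fixed $t$ the function $x \mapsto H(x,t)$ is continuous. A homotopy $H$ is punctuated if for each $t \in [0,k-1]_{\mathbb{Z}}$ there is some $x_t \in X$ such that $H(x,t)=H(x,t+1)$ for all $x \ne x_t$. On $X \times [0,k]_{\mathbb{Z}}$ the adjacency $\mathrm{NP}_2$ is: two distinct points $(x,t)$, $(x',t')$ are adjacent iff $x,x'$ are adjacent or equal and $t,t'$ are adjacent or equal. A function $H : X\times[0,k]_{\mathbb{Z}}\to Y$ is a strong homotopy if it is continuous with respect to $\mathrm{NP}_2$ on the domain and the given adjacency on $Y$. *)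

theory Defs
  imports Main "HOL-Library.FuncSet"
begin

locale digital_image =
  fixes X :: "'a set" and A :: "('a \<times> 'a) set"
  assumes adj_carrier: "A \<subseteq> X \<times> X"
    and adj_sym: "sym A"
    and adj_irrefl: "irrefl A"

definition dig_continuous ::
    "'a set \<Rightarrow> ('a \<times> 'a) set \<Rightarrow> 'b set \<Rightarrow> ('b \<times> 'b) set \<Rightarrow> ('a \<Rightarrow> 'b) \<Rightarrow> bool" where
  "dig_continuous X A Y B f \<longleftrightarrow>
     f \<in> X \<rightarrow> Y \<and> (\<forall>x x'. (x, x') \<in> A \<longrightarrow> (f x, f x') \<in> B \<or> f x = f x')"

definition int_adj :: "int \<Rightarrow> int \<Rightarrow> (int \<times> int) set" where
  "int_adj a b = {(s, t). s \<in> {a..b} \<and> t \<in> {a..b} \<and> \<bar>s - t\<bar> = 1}"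

definition NP2 ::
    "'a set \<Rightarrow> ('a \<times> 'a) set \<Rightarrow> 'c set \<Rightarrow> ('c \<times> 'c) set \<Rightarrow> (('a \<times> 'c) \<times> ('a \<times> 'c)) set" where
  "NP2 X A T C = {((x, t), (x', t')).
     (x, t) \<in> X \<times> T \<and> (x', t') \<in> X \<times> T \<and> (x, t) \<noteq> (x', t') \<and>
     ((x, x') \<in> A \<or> x = x') \<and> ((t, t') \<in> C \<or> t = t')}"

lemma digital_image_int_interval: "digital_image {a..b} (int_adj a b)"
  by unfold_locales (auto simp: int_adj_def sym_def irrefl_def)

lemma digital_image_NP2:
  assumes "digital_image X A" "digital_image T C"
  shows "digital_image (X \<times> T) (NP2 X A T C)"
  using assms by (auto simp: digital_image_def NP2_def sym_def irrefl_def)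

definition dig_homotopy ::
    "'a set \<Rightarrow> ('a \<times> 'a) set \<Rightarrow> 'b set \<Rightarrow> ('b \<times> 'b) set \<Rightarrow> int \<Rightarrow>
     ('a \<Rightarrow> 'b) \<Rightarrow> ('a \<Rightarrow> 'b) \<Rightarrow> ('a \<times> int \<Rightarrow> 'b) \<Rightarrow> bool" where
  "dig_homotopy X A Y B k f g H \<longleftrightarrow>
     dig_continuous X A Y B f \<and> dig_continuous X A Y B g \<and>
     H \<in> X \<times> {0..k} \<rightarrow> Y \<and>
     (\<forall>x\<in>X. H (x, 0) = f x) \<and> (\<forall>x\<in>X. H (x, k) = g x) \<and>
     (\<forall>x\<in>X. dig_continuous {0..k} (int_adj 0 k) Y B (\<lambda>t. H (x, t))) \<and>
     (\<forall>t\<in>{0..k}. dig_continuous X A Y B (\<lambda>x. H (x, t)))"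

definition punctuated :: "'a set \<Rightarrow> int \<Rightarrow> ('a \<times> int \<Rightarrow> 'b) \<Rightarrow> bool" where
  "punctuated X k H \<longleftrightarrow>
     (\<forall>t\<in>{0..k - 1}. \<exists>x\<^sub>t\<in>X. \<forall>x\<in>X. x \<noteq> x\<^sub>t \<longrightarrow> H (x, t) = H (x, t + 1))"

definition strong_homotopy ::
    "'a set \<Rightarrow> ('a \<times> 'a) set \<Rightarrow> 'b set \<Rightarrow> ('b \<times> 'b) set \<Rightarrow> int \<Rightarrow> ('a \<times> int \<Rightarrow> 'b) \<Rightarrow> bool" where
  "strong_homotopy X A Y B k H \<longleftrightarrow>
     dig_continuous (X \<times> {0..k}) (NP2 X A {0..k} (int_adj 0 k)) Y B H"

end

theory Submission imports Defs begin

text \<open>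
  Only diagonal adjacencies need an argument. If \<open>x\<close> and \<open>x'\<close> are adjacent, they are distinct, so at
  most one of them is the point moved between times \<open>t\<close> and \<open>t + 1\<close>; the other one is
  stationary, and sliding it in time reduces the diagonal to a spatial adjacency at a single time.
\<close>

lemma punctuated_homotopy_diagonal:
  assumes X: "digital_image X A"
    and H: "dig_homotopy X A Y B k f g H"
    and P: "punctuated X k H"
    and adj: "(x, x') \<in> A"
    and t: "t \<in> {0..k - 1}"
  shows "(H (x, t), H (x', t + 1)) \<in> B \<or> H (x, t) = H (x', t + 1)"
proof -
  \<comment> \<open>Distinctness comes from irreflexivity of \<open>A\<close>; it makes
    \<open>x'\<close> stationary whenever \<open>x\<close> is the exceptional point
    \<open>m\<close>.\<close>
  have x: "x \<in> X" "x' \<in> X" "x \<noteq> x'"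
    using X adj by (auto simp: digital_image_def irrefl_def)
  have space: "(H (x, s), H (x', s)) \<in> B \<or> H (x, s) = H (x', s)" if "s \<in> {0..k}" for s
    using H adj that by (auto simp: dig_homotopy_def dig_continuous_def)
  obtain m where m: "\<forall>z\<in>X. z \<noteq> m \<longrightarrow> H (z, t) = H (z, t + 1)"
    using P t unfolding punctuated_def by blast
  show ?thesis
  proof (cases "x = m")
    case True
    then have "H (x', t) = H (x', t + 1)" using m x by simp
    then show ?thesis using space[of t] t by auto
  next
    case False
    then have "H (x, t) = H (x, t + 1)" using m x by simp
    \<comment> \<open>Here \<open>x\<close> is stationary, so both values are compared at time
      \<open>t + 1\<close>, which is still at most \<open>k\<close> because \<open>t\<close> stops
      at \<open>k - 1\<close>.\<close>
    then show ?thesis using space[of "t + 1"] t by auto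
  qed
qed

theorem theorem13:
  fixes X :: "'a set" and A :: "('a \<times> 'a) set"
    and Y :: "'b set" and B :: "('b \<times> 'b) set"
    and k :: int and f g :: "'a \<Rightarrow> 'b" and H :: "'a \<times> int \<Rightarrow> 'b"
  assumes "digital_image X A" and "digital_image Y B"
    and "k > 0"
    and "dig_homotopy X A Y B k f g H"
    and "punctuated X k H"
  shows "strong_homotopy X A Y B k H"
proof -
  have "(H (x, t), H (x', t')) \<in> B \<or> H (x, t) = H (x', t')"
    if np: "((x, t), (x', t')) \<in> NP2 X A {0..k} (int_adj 0 k)" for x t x' t'
  proof -
    have dom: "x \<in> X" "t \<in> {0..k}" "t' \<in> {0..k}"
      and sp: "(x, x') \<in> A \<or> x = x'" and ti: "(t, t') \<in> int_adj 0 k \<or> t = t'"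
      using np by (auto simp: NP2_def)
    \<comment> \<open>The two diagonals are separated by the direction of time, since
      \<open>punctuated_homotopy_diagonal\<close> only steps forward.\<close>
    consider "x = x'" "t = t'" | "x = x'" "(t, t') \<in> int_adj 0 k" | "(x, x') \<in> A" "t = t'"
      | "(x, x') \<in> A" "t' = t + 1" | "(x, x') \<in> A" "t = t' + 1"
      using sp ti by (auto simp: int_adj_def abs_if split: if_splits)
    then show ?thesis
    proof cases
      case 1
      then show ?thesis by simp
    next
      case 2
      then show ?thesis using assms(4) dom by (auto simp: dig_homotopy_def dig_continuous_def)
    next
      case 3
      then show ?thesis using assms(4) dom by (auto simp: dig_homotopy_def dig_continuous_def)
    next
      case 4
      then show ?thesis
        using punctuated_homotopy_diagonal[OF assms(1,4,5), of x x' t] dom by auto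
    next
      case 5
      \<comment> \<open>A backward diagonal is a forward one from \<open>(x', t')\<close> to
        \<open>(x, t)\<close>: symmetry of \<open>A\<close> swaps the endpoints, and symmetry of
        \<open>B\<close> swaps the values back.\<close>
      have "(x', x) \<in> A" using 5 assms(1) by (auto simp: digital_image_def dest: symD)
      then have "(H (x', t'), H (x, t)) \<in> B \<or> H (x', t') = H (x, t)"
        using punctuated_homotopy_diagonal[OF assms(1,4,5), of x' x t'] dom 5 by auto
      then show ?thesis using assms(2) by (auto simp: digital_image_def dest: symD)
    qed
  qed
  moreover have "H \<in> X \<times> {0..k} \<rightarrow> Y" using assms(4) by (simp add: dig_homotopy_def)
  ultimately show ?thesis by (auto simp: strong_homotopy_def dig_continuous_def)
qed

end
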